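(* Let $\beta,\gamma\in(0,1)$, let the supply and demand assumptions in the context hold, and let $p_L<p_{\rm bal}<p_H$. Put $f:=\dfrac{p_L}{p_H}$, $\rho:=\dfrac{c(p_H)}{w(\gamma p_L)}$, $\rho_w:=\dfrac{w(\gamma p_L)}{w(\gamma p_H)}$ and $\rho_c:=\dfrac{c(p_H)}{c(p_L)}$. Then in the revenue competition game (first entry: Platform 1's price, second entry: Platform 2's price): 1. $(L,L)$ is a Nash equilibrium iff $f\ge\frac{\rho}{1-\beta}$ and $f\ge\frac{\rho}{\beta}$. 2. $(L,H)$ is a Nash equilibrium iff $\frac1f\le\min\{\frac1{1-\beta},\frac1{\rho_c},\frac1{\rho\beta},\frac1{\rho\rho_w}\}$ and $f\le\frac{\rho}{1-\beta}$. 3. $(H,L)$ is a Nash equilibrium iff $\frac1f\le\min\{\frac1{\beta},\frac1{\rho_c},\frac1{\rho(1-\beta)},\frac1{\rho\rho_w}\}$ and $f\le\frac{\rho}{\beta}$. 4. $(H,H)$ is a Nash equilibrium iff $\frac1f\ge\min\{\frac1{1-\beta},\frac1{\rho_c},\frac1{\rho\beta},\frac1{\rho\rho_w}\}$ and $\frac1f\ge\min\{\frac1{\beta},\frac1{\rho_c},\frac1{\rho(1-\beta)},\frac1{\rho\rho_w}\}$.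
   Context: Supply and demand assumptions. $w(p)>0$ (supply) and $c(p)>0$ (demand) are real-valued functions of the price $p>0$; $c$ is strictly decreasing, $w$ is strictly increasing; $0<p_L<p_H$; there is a unique price $p_{\rm bal}$ with $w(\gamma p_{\rm bal})=c(p_{\rm bal})$. Revenue game. Two platforms simultaneously choose a strategy in $\{L,H\}$, i.e. a price $p_1$ (Platform 1), $p_2$ (Platform 2) in $\{p_L,p_H\}$. Given $(p_1,p_2)$, the throughput of Platform 1 is $$N_1(p_1,p_2)=\min\Big\{w(\gamma p_1),\tfrac{\beta}{1-\beta}w(\gamma p_2),c(p_1),\tfrac{\beta}{1-\beta}c(p_2),\beta c(\min\{p_1,p_2\}),\beta w(\max\{\gamma p_1,\gamma p_2\})\Big\}$$ and the throughput of Platform 2 is $N_2(p_1,p_2)=\frac{1-\beta}{\beta}N_1(p_1,p_2)$. (These are the numbers of matched worker–customer pairs at the two platforms in the aggregate-utility-maximizing allocation of users under customer loyalty $\beta$.) The payoff of Platform $i$ is its revenue $(1-\gamma)\,p_i\,N_i(p_1,p_2)$. A pair of strategies is a (pure strategy) Nash equilibrium if no platform can strictly increase its payoff by a unilateral change of strategy. *)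

theory Defs
  imports Complex_Main
begin

text \<open>Here \<open>\<gamma> * p\<close> is what a worker receives and \<open>(1 - \<gamma>) * p\<close> is what the platform
  keeps when a customer pays \<open>p\<close>. The throughput is the number of matched
  worker-customer pairs at a platform in the allocation of users that maximizes aggregate
  utility under customer loyalty \<open>\<beta>\<close>. In every definition \<open>p1\<close> and \<open>p2\<close> are the prices of
  Platform 1 and Platform 2.\<close>

definition throughput1 ::
  "(real \<Rightarrow> real) \<Rightarrow> (real \<Rightarrow> real) \<Rightarrow> real \<Rightarrow> real \<Rightarrow> real \<Rightarrow> real \<Rightarrow> real" where
  "throughput1 w c \<beta> \<gamma> p1 p2 =
     Min {w (\<gamma> * p1), \<beta> / (1 - \<beta>) * w (\<gamma> * p2),
          c p1, \<beta> / (1 - \<beta>) * c p2,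
          \<beta> * c (min p1 p2), \<beta> * w (max (\<gamma> * p1) (\<gamma> * p2))}"

definition throughput2 ::
  "(real \<Rightarrow> real) \<Rightarrow> (real \<Rightarrow> real) \<Rightarrow> real \<Rightarrow> real \<Rightarrow> real \<Rightarrow> real \<Rightarrow> real" where
  "throughput2 w c \<beta> \<gamma> p1 p2 = (1 - \<beta>) / \<beta> * throughput1 w c \<beta> \<gamma> p1 p2"

definition revenue1 ::
  "(real \<Rightarrow> real) \<Rightarrow> (real \<Rightarrow> real) \<Rightarrow> real \<Rightarrow> real \<Rightarrow> real \<Rightarrow> real \<Rightarrow> real" where
  "revenue1 w c \<beta> \<gamma> p1 p2 = (1 - \<gamma>) * p1 * throughput1 w c \<beta> \<gamma> p1 p2"

definition revenue2 ::
  "(real \<Rightarrow> real) \<Rightarrow> (real \<Rightarrow> real) \<Rightarrow> real \<Rightarrow> real \<Rightarrow> real \<Rightarrow> real \<Rightarrow> real" where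
  "revenue2 w c \<beta> \<gamma> p1 p2 = (1 - \<gamma>) * p2 * throughput2 w c \<beta> \<gamma> p1 p2"

definition nash_equilibrium ::
  "'s set \<Rightarrow> ('s \<Rightarrow> 's \<Rightarrow> real) \<Rightarrow> ('s \<Rightarrow> 's \<Rightarrow> real) \<Rightarrow> 's \<times> 's \<Rightarrow> bool" where
  "nash_equilibrium S u1 u2 = (\<lambda>(s1, s2).
     s1 \<in> S \<and> s2 \<in> S \<and>
     \<not> (\<exists>t\<in>S. u1 t s2 > u1 s1 s2) \<and>
     \<not> (\<exists>t\<in>S. u2 s1 t > u2 s1 s2))"

text \<open>A strategy is identified with the price it sets, so the strategy set is \<open>{p_L, p_H}\<close>.\<close>

definition revenue_game_nash ::
  "(real \<Rightarrow> real) \<Rightarrow> (real \<Rightarrow> real) \<Rightarrow> real \<Rightarrow> real \<Rightarrow> real \<Rightarrow> real \<Rightarrow> real \<times> real \<Rightarrow> bool" where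
  "revenue_game_nash w c \<beta> \<gamma> p_L p_H =
     nash_equilibrium {p_L, p_H} (revenue1 w c \<beta> \<gamma>) (revenue2 w c \<beta> \<gamma>)"

end

theory Submission
  imports Defs
begin

text \<open>
  Platform 2 faces the game that Platform 1 faces when the loyalty is \<open>1 - \<beta>\<close> and the two prices
  are swapped, so only the incentives of Platform 1 need to be computed, against each of the two
  prices of its competitor.

  Because \<open>p_L < p_bal < p_H\<close>, supply is the scarce side at \<open>p_L\<close> and demand is the scarce side at
  \<open>p_H\<close>. Hence the throughput of Platform 1 is \<open>\<beta> * w (\<gamma> * p_L)\<close> when both prices are low and
  \<open>\<beta> * c p_H\<close> when both are high. Relative to these values, deviating from equal prices multiplies
  the throughput by a minimum of four ratios, and it changes the price by the factor \<open>f\<close> or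
  \<open>1 / f\<close>. For a deviation to \<open>p_L\<close> all four ratios can be the binding one, and they are the
  entries of the minima in the theorem. For a deviation to \<open>p_H\<close> three of the ratios exceed
  \<open>1 > f\<close>, so that only \<open>\<rho> / \<beta>\<close> (or \<open>\<rho> / (1 - \<beta>)\<close> for Platform 2) can decide whether the
  deviation pays.
\<close>

lemma Min_eq_Min_dominating:
  fixes A B :: "'a::linorder set"
  assumes "finite A" "B \<subseteq> A" "A \<noteq> {}" "\<And>y. y \<in> A \<Longrightarrow> \<exists>x\<in>B. x \<le> y"
  shows "Min B = Min A"
proof (rule antisym)
  have "finite B" "B \<noteq> {}"
    using assms by (auto intro: finite_subset)
  then show "Min A \<le> Min B"
    using assms by (intro Min_antimono)
  show "Min B \<le> Min A"
    using assms \<open>finite B\<close> by (meson Min_in Min_le order_trans)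
qed

text \<open>Multiplying by \<open>(1 - \<beta>) / \<beta>\<close> turns the bounds scaled by \<open>\<beta> / (1 - \<beta>)\<close> into unscaled
  ones and vice versa, which exchanges the roles of the platforms.\<close>

lemma throughput2_eq_throughput1:
  assumes "0 < \<beta>" "\<beta> < 1"
  shows "throughput2 w c \<beta> \<gamma> p1 p2 = throughput1 w c (1 - \<beta>) \<gamma> p2 p1"
proof -
  have "0 \<le> (1 - \<beta>) / \<beta>"
    using assms by simp
  then show ?thesis
    using assms
    by (simp add: throughput2_def throughput1_def min_mult_distrib_left min.commute
        min.left_commute max.commute)
qed

lemma revenue2_eq_revenue1:
  assumes "0 < \<beta>" "\<beta> < 1"
  shows "revenue2 w c \<beta> \<gamma> p1 p2 = revenue1 w c (1 - \<beta>) \<gamma> p2 p1"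
  using assms by (simp add: revenue1_def revenue2_def throughput2_eq_throughput1)

locale two_price_market =
  fixes w c :: "real \<Rightarrow> real" and \<gamma> p_L p_H :: real
  assumes gamma: "0 < \<gamma>" "\<gamma> < 1"
    and prices: "0 < p_L" "p_L < p_H"
    and w_low_pos: "0 < w (\<gamma> * p_L)" and c_high_pos: "0 < c p_H"
    and w_less: "w (\<gamma> * p_L) < w (\<gamma> * p_H)"
    and c_less: "c p_H < c p_L"
    and low_supply_scarce: "w (\<gamma> * p_L) < c p_L"
    and high_demand_scarce: "c p_H < w (\<gamma> * p_H)"
begin

definition "price_ratio = p_L / p_H"

definition "scarcity_ratio = c p_H / w (\<gamma> * p_L)"

text \<open>The factor by which Platform 1 changes its throughput when it undercuts a competitor with
  price \<open>p_H\<close> instead of matching that price. The entries come from the competitor's demand, the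
  loyal share of the demand at \<open>p_L\<close>, the own supply, and the loyal share of the supply at \<open>p_H\<close>.\<close>

definition undercut_gain :: "real \<Rightarrow> real" where
  "undercut_gain \<beta> = Min {1 / (1 - \<beta>), 1 / (c p_H / c p_L), 1 / (scarcity_ratio * \<beta>),
     1 / (scarcity_ratio * (w (\<gamma> * p_L) / w (\<gamma> * p_H)))}"

text \<open>The factor by which Platform 1 changes its throughput when it raises its price above that of
  a competitor with price \<open>p_L\<close> instead of matching it. The entries come from the competitor's
  supply, the own demand, and the loyal shares of the demand at \<open>p_L\<close> and the supply at \<open>p_H\<close>.\<close>

definition raise_gain :: "real \<Rightarrow> real" where
  "raise_gain \<beta> = Min {1 / (1 - \<beta>), scarcity_ratio / \<beta>, c p_L / w (\<gamma> * p_L),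
     w (\<gamma> * p_H) / w (\<gamma> * p_L)}"

lemma c_low_pos: "0 < c p_L"
  using c_high_pos c_less by simp

lemma w_high_pos: "0 < w (\<gamma> * p_H)"
  using w_low_pos w_less by simp

lemma low_high_extremes: "min p_L p_H = p_L" "max (\<gamma> * p_L) (\<gamma> * p_H) = \<gamma> * p_H"
  and high_low_extremes: "min p_H p_L = p_L" "max (\<gamma> * p_H) (\<gamma> * p_L) = \<gamma> * p_H"
  using gamma prices by (simp_all add: min_def max_def)

context
  fixes \<beta> :: real
  assumes beta: "0 < \<beta>" "\<beta> < 1"
begin

text \<open>The throughput is bounded by a share \<open>\<beta>\<close> of the larger supply and of the larger demand. By
  these inequalities such a bound is tighter than the bound that the same supply or demand imposes
  at a single platform. With equal prices this leaves only the two shares, and with different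
  prices the bounds from the larger supply and the larger demand at a single platform drop
  out.\<close>

lemma loyalty_shrinks:
  assumes "0 < x"
  shows "\<beta> * x \<le> x" "\<beta> * x \<le> \<beta> / (1 - \<beta>) * x"
  using beta assms by (simp_all add: field_simps)

lemma throughput1_low_low: "throughput1 w c \<beta> \<gamma> p_L p_L = \<beta> * w (\<gamma> * p_L)"
proof -
  have "\<beta> * w (\<gamma> * p_L) \<le> \<beta> * c p_L" "0 < c p_L"
    using beta w_low_pos low_supply_scarce by simp_all
  moreover from this have "\<beta> * w (\<gamma> * p_L) \<le> c p_L"
    "\<beta> * w (\<gamma> * p_L) \<le> \<beta> / (1 - \<beta>) * c p_L"
    using loyalty_shrinks[of "c p_L"] by (blast intro: order_trans)+
  ultimately show ?thesis
    unfolding throughput1_def min.idem max.idem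
    by (intro Min_eqI) (use loyalty_shrinks[OF w_low_pos] in blast)+
qed

lemma throughput1_high_high: "throughput1 w c \<beta> \<gamma> p_H p_H = \<beta> * c p_H"
proof -
  have "\<beta> * c p_H \<le> \<beta> * w (\<gamma> * p_H)" "0 < w (\<gamma> * p_H)"
    using beta c_high_pos high_demand_scarce by simp_all
  moreover from this have "\<beta> * c p_H \<le> w (\<gamma> * p_H)"
    "\<beta> * c p_H \<le> \<beta> / (1 - \<beta>) * w (\<gamma> * p_H)"
    using loyalty_shrinks[of "w (\<gamma> * p_H)"] by (blast intro: order_trans)+
  ultimately show ?thesis
    unfolding throughput1_def min.idem max.idem
    by (intro Min_eqI) (use loyalty_shrinks[OF c_high_pos] in blast)+
qed

lemma throughput1_low_high:
  "throughput1 w c \<beta> \<gamma> p_L p_H = \<beta> * c p_H * undercut_gain \<beta>"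
proof -
  have k: "0 \<le> \<beta> * c p_H"
    using beta c_high_pos by simp
  have "\<beta> * c p_H * undercut_gain \<beta> =
      Min {\<beta> / (1 - \<beta>) * c p_H, \<beta> * c p_L, w (\<gamma> * p_L), \<beta> * w (\<gamma> * p_H)}"
    using beta w_low_pos c_high_pos w_less c_less k
    by (simp add: undercut_gain_def scarcity_ratio_def min_mult_distrib_left)
  also have "\<dots> = throughput1 w c \<beta> \<gamma> p_L p_H"
    unfolding throughput1_def low_high_extremes
    by (intro Min_eq_Min_dominating)
      (use loyalty_shrinks[of "c p_L"] loyalty_shrinks[of "w (\<gamma> * p_H)"] w_high_pos c_low_pos
        in blast)+
  finally show ?thesis by simp
qed

lemma throughput1_high_low:
  "throughput1 w c \<beta> \<gamma> p_H p_L = \<beta> * w (\<gamma> * p_L) * raise_gain \<beta>"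
proof -
  have k: "0 \<le> \<beta> * w (\<gamma> * p_L)"
    using beta w_low_pos by simp
  have "\<beta> * w (\<gamma> * p_L) * raise_gain \<beta> =
      Min {\<beta> / (1 - \<beta>) * w (\<gamma> * p_L), c p_H, \<beta> * c p_L, \<beta> * w (\<gamma> * p_H)}"
    using beta w_low_pos k
    by (simp add: raise_gain_def scarcity_ratio_def min_mult_distrib_left)
  also have "\<dots> = throughput1 w c \<beta> \<gamma> p_H p_L"
    unfolding throughput1_def high_low_extremes
    by (intro Min_eq_Min_dominating)
      (use loyalty_shrinks[of "c p_L"] loyalty_shrinks[of "w (\<gamma> * p_H)"] w_high_pos c_low_pos
        in blast)+
  finally show ?thesis by simp
qed

lemma revenue1_vs_high:
  shows undercutting_unprofitable_iff:
      "revenue1 w c \<beta> \<gamma> p_L p_H \<le> revenue1 w c \<beta> \<gamma> p_H p_H \<longleftrightarrow>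
        undercut_gain \<beta> \<le> 1 / price_ratio"
    and matching_high_unprofitable_iff:
      "revenue1 w c \<beta> \<gamma> p_H p_H \<le> revenue1 w c \<beta> \<gamma> p_L p_H \<longleftrightarrow>
        1 / price_ratio \<le> undercut_gain \<beta>"
proof -
  define k where "k = (1 - \<gamma>) * p_L * (\<beta> * c p_H)"
  have "0 < k"
    using beta gamma prices c_high_pos by (simp add: k_def)
  have low: "revenue1 w c \<beta> \<gamma> p_L p_H = k * undercut_gain \<beta>"
    by (simp add: revenue1_def throughput1_low_high k_def)
  have high: "revenue1 w c \<beta> \<gamma> p_H p_H = k * (1 / price_ratio)"
    using prices by (simp add: revenue1_def throughput1_high_high k_def price_ratio_def)
  show "revenue1 w c \<beta> \<gamma> p_L p_H \<le> revenue1 w c \<beta> \<gamma> p_H p_H \<longleftrightarrow>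
      undercut_gain \<beta> \<le> 1 / price_ratio"
    "revenue1 w c \<beta> \<gamma> p_H p_H \<le> revenue1 w c \<beta> \<gamma> p_L p_H \<longleftrightarrow>
      1 / price_ratio \<le> undercut_gain \<beta>"
    unfolding low high using \<open>0 < k\<close> by (simp_all only: mult_le_cancel_left_pos)
qed

text \<open>Since \<open>price_ratio < 1\<close>, comparing it with \<open>raise_gain \<beta>\<close> is the same as comparing it with
  \<open>scarcity_ratio / \<beta>\<close>: the other three entries of that minimum are greater than \<open>1\<close>.\<close>

lemma revenue1_vs_low:
  shows raising_unprofitable_iff:
      "revenue1 w c \<beta> \<gamma> p_H p_L \<le> revenue1 w c \<beta> \<gamma> p_L p_L \<longleftrightarrow>
        scarcity_ratio / \<beta> \<le> price_ratio"
    and matching_low_unprofitable_iff: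
      "revenue1 w c \<beta> \<gamma> p_L p_L \<le> revenue1 w c \<beta> \<gamma> p_H p_L \<longleftrightarrow>
        price_ratio \<le> scarcity_ratio / \<beta>"
proof -
  define k where "k = (1 - \<gamma>) * p_H * (\<beta> * w (\<gamma> * p_L))"
  have "0 < k"
    using beta gamma prices w_low_pos by (simp add: k_def)
  have high: "revenue1 w c \<beta> \<gamma> p_H p_L = k * raise_gain \<beta>"
    by (simp add: revenue1_def throughput1_high_low k_def)
  have low: "revenue1 w c \<beta> \<gamma> p_L p_L = k * price_ratio"
    using prices by (simp add: revenue1_def throughput1_low_low k_def price_ratio_def)
  have "price_ratio < 1"
    using prices by (simp add: price_ratio_def)
  moreover have "1 < 1 / (1 - \<beta>)" "1 < c p_L / w (\<gamma> * p_L)"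
    "1 < w (\<gamma> * p_H) / w (\<gamma> * p_L)"
    using beta w_low_pos low_supply_scarce w_less by (simp_all add: field_simps)
  ultimately have "raise_gain \<beta> \<le> price_ratio \<longleftrightarrow> scarcity_ratio / \<beta> \<le> price_ratio"
    and "price_ratio \<le> raise_gain \<beta> \<longleftrightarrow> price_ratio \<le> scarcity_ratio / \<beta>"
    by (auto simp: raise_gain_def min_le_iff_disj)
  then show "revenue1 w c \<beta> \<gamma> p_H p_L \<le> revenue1 w c \<beta> \<gamma> p_L p_L \<longleftrightarrow>
      scarcity_ratio / \<beta> \<le> price_ratio"
    "revenue1 w c \<beta> \<gamma> p_L p_L \<le> revenue1 w c \<beta> \<gamma> p_H p_L \<longleftrightarrow>
      price_ratio \<le> scarcity_ratio / \<beta>"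
    unfolding low high using \<open>0 < k\<close> by (simp_all only: mult_le_cancel_left_pos)
qed

end

lemma revenue_game_nash_iff:
  assumes "0 < \<beta>" "\<beta> < 1" "s1 \<in> {p_L, p_H}" "s2 \<in> {p_L, p_H}"
  shows "revenue_game_nash w c \<beta> \<gamma> p_L p_H (s1, s2) \<longleftrightarrow>
    (\<forall>t\<in>{p_L, p_H}. revenue1 w c \<beta> \<gamma> t s2 \<le> revenue1 w c \<beta> \<gamma> s1 s2) \<and>
    (\<forall>t\<in>{p_L, p_H}. revenue1 w c (1 - \<beta>) \<gamma> t s1 \<le> revenue1 w c (1 - \<beta>) \<gamma> s2 s1)"
  using assms
  by (auto simp: revenue_game_nash_def nash_equilibrium_def revenue2_eq_revenue1 not_less)

end

theorem mainTheorem10: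
  fixes w c :: "real \<Rightarrow> real"
    and \<beta> \<gamma> p_L p_H p_bal f \<rho> \<rho>_w \<rho>_c :: real
  assumes beta: "\<beta> \<in> {0<..<1}"
    and gamma: "\<gamma> \<in> {0<..<1}"
    and w_pos: "\<And>p. p > 0 \<Longrightarrow> w p > 0"
    and c_pos: "\<And>p. p > 0 \<Longrightarrow> c p > 0"
    and w_incr: "strict_mono_on {0<..} w"
    and c_decr: "strict_antimono_on {0<..} c"
    and p_L_pos: "0 < p_L"
    and p_L_less_p_H: "p_L < p_H"
    and p_bal: "p_bal > 0" "w (\<gamma> * p_bal) = c p_bal"
    and p_bal_unique: "\<And>p. p > 0 \<Longrightarrow> w (\<gamma> * p) = c p \<Longrightarrow> p = p_bal"
    and p_L_less_p_bal: "p_L < p_bal"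
    and p_bal_less_p_H: "p_bal < p_H"
    and f: "f = p_L / p_H"
    and rho: "\<rho> = c p_H / w (\<gamma> * p_L)"
    and rho_w: "\<rho>_w = w (\<gamma> * p_L) / w (\<gamma> * p_H)"
    and rho_c: "\<rho>_c = c p_H / c p_L"
  shows
    "(revenue_game_nash w c \<beta> \<gamma> p_L p_H (p_L, p_L) \<longleftrightarrow>
        f \<ge> \<rho> / (1 - \<beta>) \<and> f \<ge> \<rho> / \<beta>) \<and>
     (revenue_game_nash w c \<beta> \<gamma> p_L p_H (p_L, p_H) \<longleftrightarrow>
        1 / f \<le> Min {1 / (1 - \<beta>), 1 / \<rho>_c, 1 / (\<rho> * \<beta>), 1 / (\<rho> * \<rho>_w)} \<and>
        f \<le> \<rho> / (1 - \<beta>)) \<and>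
     (revenue_game_nash w c \<beta> \<gamma> p_L p_H (p_H, p_L) \<longleftrightarrow>
        1 / f \<le> Min {1 / \<beta>, 1 / \<rho>_c, 1 / (\<rho> * (1 - \<beta>)), 1 / (\<rho> * \<rho>_w)} \<and>
        f \<le> \<rho> / \<beta>) \<and>
     (revenue_game_nash w c \<beta> \<gamma> p_L p_H (p_H, p_H) \<longleftrightarrow>
        1 / f \<ge> Min {1 / (1 - \<beta>), 1 / \<rho>_c, 1 / (\<rho> * \<beta>), 1 / (\<rho> * \<rho>_w)} \<and>
        1 / f \<ge> Min {1 / \<beta>, 1 / \<rho>_c, 1 / (\<rho> * (1 - \<beta>)), 1 / (\<rho> * \<rho>_w)})"
proof -
  have "w (\<gamma> * p_L) < w (\<gamma> * p_bal)" "w (\<gamma> * p_bal) < w (\<gamma> * p_H)"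
    using gamma p_L_pos p_L_less_p_bal p_bal_less_p_H
    by (auto intro!: strict_mono_onD[OF w_incr])
  moreover have "c p_bal < c p_L" "c p_H < c p_bal"
    using p_L_pos p_L_less_p_bal p_bal_less_p_H
    by (auto intro!: monotone_onD[OF c_decr])
  ultimately interpret two_price_market w c \<gamma> p_L p_H
    using gamma p_L_pos p_L_less_p_H w_pos[of "\<gamma> * p_L"] c_pos[of p_H] p_bal(2)
    by unfold_locales auto
  have b: "0 < \<beta>" "\<beta> < 1" and b': "0 < 1 - \<beta>" "1 - \<beta> < 1"
    using beta by auto
  have f': "f = price_ratio" and rho': "\<rho> = scarcity_ratio"
    by (simp_all add: f rho price_ratio_def scarcity_ratio_def)
  have gain: "Min {1 / (1 - \<beta>), 1 / \<rho>_c, 1 / (\<rho> * \<beta>), 1 / (\<rho> * \<rho>_w)} = undercut_gain \<beta>"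
    and gain': "Min {1 / \<beta>, 1 / \<rho>_c, 1 / (\<rho> * (1 - \<beta>)), 1 / (\<rho> * \<rho>_w)} =
      undercut_gain (1 - \<beta>)"
    by (simp_all only: undercut_gain_def rho' rho_w rho_c diff_diff_eq2 add_diff_cancel_left')
  show ?thesis
    unfolding gain gain' unfolding f' rho'
    by (auto simp: revenue_game_nash_iff[OF b] revenue1_vs_high[OF b] revenue1_vs_high[OF b']
        revenue1_vs_low[OF b] revenue1_vs_low[OF b'])
qed

end
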